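(* Let $\rho=\rho_1\rho_2\cdots\rho_k$ be a factorization in a symmetric group $\mathcal{S}_V$ which is the concatenation of $k$ factorizations $\rho_1,\dots,\rho_k$ in $\mathcal{S}_V$. Then the mind-body dual of $\rho$ is the concatenation $$\rho^{*}=\rho_1^{*}\ \ {}^{\mu(\rho_1)}\!\left(\rho_2^{*}\right)\ \cdots\ \ {}^{\mu(\rho_1\cdots\rho_{k-1})}\!\left(\rho_k^{*}\right).$$
   Context: $V$ is a finite set; permutations are multiplied from left to right, and ${}^{h}g:=hgh^{-1}$. A factorization in $\mathcal{S}_V$ is a finite sequence $\rho=(\tau_1,\dots,\tau_m)$ of transpositions of $V$; its monodromy is the product $\mu(\rho)=\tau_1\cdots\tau_m$. Concatenation of factorizations is concatenation of sequences and is written as juxtaposition. For $h\in\mathcal{S}_V$, ${}^{h}\rho:=({}^{h}\tau_1,\dots,{}^{h}\tau_m)$. The associated e-graph of $\rho$ has vertex set $V$ and for each $i\in[m]$ an edge labeled $i$ joining the two points moved by $\tau_i$ (this is a bijection between factorizations of length $m$ in $\mathcal{S}_V$ and loopless graphs on $V$ with $m$ edges labeled bijectively by $[m]$, multiple edges allowed). For a vertex $v$ of such a graph $\Gamma$ the minimally increasing greedy trail (migt) $\overrightarrow{v}$ starts at $v$ along the smallest-labeled edge at $v$; after arriving at a vertex $w$ along an edge $e$ it continues with the smallest-labeled edge at $w$ larger than $e$, and stops if there is none. If $v$ is isolated, $\overrightarrow{v}$ is the trivial trail. Every edge belongs to exactly two migts. The mind-body dual $\Gamma^*$ has vertices $v^*=\overrightarrow{v}$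 (identified with $v$) and for each $i$ an edge labeled $i$ joining the two migts that contain the edge of $\Gamma$ labeled $i$. The mind-body dual $\rho^*$ is the factorization associated with the mind-body dual of the e-graph of $\rho$. *)

theory Defs
  imports "HOL-Combinatorics.Transposition"
begin

text \<open>
  Permutations are multiplied from left to right, i.e. the product of \<open>g\<close> and \<open>h\<close> is
  \<open>fcomp g h\<close>, which applies \<open>g\<close> first.
\<close>

type_synonym 'a factorization = "('a \<Rightarrow> 'a) list"

definition transpositions :: "'a set \<Rightarrow> ('a \<Rightarrow> 'a) set" where
  "transpositions V = {transpose a b | a b. a \<in> V \<and> b \<in> V \<and> a \<noteq> b}"

definition is_factorization :: "'a set \<Rightarrow> 'a factorization \<Rightarrow> bool" where
  "is_factorization V \<rho> \<longleftrightarrow> set \<rho> \<subseteq> transpositions V"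

definition monodromy :: "'a factorization \<Rightarrow> 'a \<Rightarrow> 'a" where
  "monodromy \<rho> = foldr fcomp \<rho> id"

definition conj_perm :: "('a \<Rightarrow> 'a) \<Rightarrow> ('a \<Rightarrow> 'a) \<Rightarrow> 'a \<Rightarrow> 'a" where
  "conj_perm h g = fcomp (fcomp h g) (inv h)"

definition conj_factorization :: "('a \<Rightarrow> 'a) \<Rightarrow> 'a factorization \<Rightarrow> 'a factorization" where
  "conj_factorization h \<rho> = map (conj_perm h) \<rho>"

text \<open>
  A loopless multigraph with edges labeled by \<open>1, \<dots>, edge_count\<close>; \<open>ends i\<close> is the two-element
  set of endpoints of the edge labeled \<open>i\<close> and is irrelevant for other \<open>i\<close>.
\<close>

record 'a egraph =
  verts :: "'a set"
  edge_count :: nat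
  ends :: "nat \<Rightarrow> 'a set"

definition egraph_of :: "'a set \<Rightarrow> 'a factorization \<Rightarrow> 'a egraph" where
  "egraph_of V \<rho> =
     \<lparr>verts = V, edge_count = length \<rho>, ends = (\<lambda>i. {x \<in> V. (\<rho> ! (i - 1)) x \<noteq> x})\<rparr>"

definition edge_transposition :: "'a set \<Rightarrow> 'a \<Rightarrow> 'a" where
  "edge_transposition e = (THE \<tau>. \<exists>a b. a \<noteq> b \<and> e = {a, b} \<and> \<tau> = transpose a b)"

definition factorization_of :: "'a egraph \<Rightarrow> 'a factorization" where
  "factorization_of G = map (\<lambda>i. edge_transposition (ends G i)) [1..<Suc (edge_count G)]"

definition labels_at_above :: "'a egraph \<Rightarrow> 'a \<Rightarrow> nat \<Rightarrow> nat set" where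
  "labels_at_above G v i = {j \<in> {1..edge_count G}. v \<in> ends G j \<and> i < j}"

definition other_end :: "'a egraph \<Rightarrow> nat \<Rightarrow> 'a \<Rightarrow> 'a" where
  "other_end G j v = (THE w. ends G j = {v, w})"

text \<open>
  The steps of the greedy trail continuing from \<open>v\<close> after arriving along the edge labeled \<open>i\<close>,
  each step being the label of the edge traversed and the vertex reached. As labels start at 1,
  \<open>i = 0\<close> means that no edge has been traversed yet.
\<close>

function greedy_steps :: "'a egraph \<Rightarrow> 'a \<Rightarrow> nat \<Rightarrow> (nat \<times> 'a) list" where
  "greedy_steps G v i =
     (if labels_at_above G v i = {} then []
      else let j = Min (labels_at_above G v i); w = other_end G j v
           in (j, w) # greedy_steps G w j)"
  by pat_completeness auto
termination
proof (relation "measure (\<lambda>(G, v, i). edge_count G - i)", goal_cases)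
  case 1
  show ?case by simp
next
  case (2 G v i j w)
  have "finite (labels_at_above G v i)"
    by (simp add: labels_at_above_def)
  with 2 have "j \<in> labels_at_above G v i"
    using Min_in by metis
  then show ?case
    by (auto simp: labels_at_above_def)
qed

declare greedy_steps.simps [simp del]

text \<open>A trail consists of its initial vertex and its steps.\<close>

definition migt :: "'a egraph \<Rightarrow> 'a \<Rightarrow> 'a \<times> (nat \<times> 'a) list" where
  "migt G v = (v, greedy_steps G v 0)"

definition trail_labels :: "'a \<times> (nat \<times> 'a) list \<Rightarrow> nat set" where
  "trail_labels t = fst ` set (snd t)"

text \<open>
  The vertices of the dual are the trails \<open>migt G v\<close>, each identified with its initial vertex
  \<open>v\<close>. If \<open>G\<close> is finite and loopless, every edge lies on
  exactly two of them, so the edges of the dual are again two-element sets.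
\<close>

definition dual_egraph :: "'a egraph \<Rightarrow> 'a egraph" where
  "dual_egraph G =
     \<lparr>verts = verts G, edge_count = edge_count G,
      ends = (\<lambda>i. {v \<in> verts G. i \<in> trail_labels (migt G v)})\<rparr>"

definition mind_body_dual :: "'a set \<Rightarrow> 'a factorization \<Rightarrow> 'a factorization" where
  "mind_body_dual V \<rho> = factorization_of (dual_egraph (egraph_of V \<rho>))"

end

theory Submission
  imports Defs "HOL-Combinatorics.Permutations"
begin

text \<open>
  The greedy trail from \<open>v\<close> can be read as a token that starts at \<open>v\<close> and watches the
  transpositions of the factorization being applied one after the other: it moves along edge \<open>i\<close>
  exactly when the \<open>i\<close>-th transposition moves its current position. So before time \<open>i\<close> the token
  sits at the image of \<open>v\<close> under the product \<open>h\<close> of the first \<open>i - 1\<close> transpositions, and the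
  trail contains edge \<open>i\<close> iff \<open>\<tau>\<^sub>i\<close> moves \<open>h v\<close>, that is, iff the conjugate of \<open>\<tau>\<^sub>i\<close> by \<open>h\<close> moves
  \<open>v\<close>. Hence the \<open>i\<close>-th entry of the dual is this conjugate (\<open>mind_body_dual_nth\<close>).

  With this formula the theorem is immediate for two factors: for an entry of the second factor,
  the prefix product splits as the monodromy of the first factor times a prefix product inside the
  second, and conjugation by a product is iterated conjugation (\<open>mind_body_dual_append\<close>). The
  general case follows by splitting off the last factor.
\<close>

section \<open>Transpositions, monodromy and conjugation\<close>

lemma transpositions_permutes: "\<tau> \<in> transpositions V \<Longrightarrow> \<tau> permutes V"
  by (auto simp: transpositions_def permutes_swap_id)

lemma monodromy_Nil [simp]: "monodromy [] = id"
  by (simp add: monodromy_def)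

lemma monodromy_Cons [simp]: "monodromy (\<tau> # \<rho>) = fcomp \<tau> (monodromy \<rho>)"
  by (simp add: monodromy_def)

lemma monodromy_append: "monodromy (\<rho> @ \<sigma>) = fcomp (monodromy \<rho>) (monodromy \<sigma>)"
  by (induction \<rho>) (simp_all add: fcomp_assoc)

lemma monodromy_permutes:
  assumes "is_factorization V \<rho>"
  shows "monodromy \<rho> permutes V"
  using assms
proof (induction \<rho>)
  case Nil
  show ?case unfolding monodromy_Nil by (rule permutes_id)
next
  case (Cons \<tau> \<rho>)
  then have "\<tau> permutes V" "monodromy \<rho> permutes V"
    by (auto simp: is_factorization_def intro: transpositions_permutes)
  then show ?case
    unfolding monodromy_Cons fcomp_comp by (intro permutes_compose)
qed

lemma is_factorization_append [simp]:
  "is_factorization V (\<rho> @ \<sigma>) \<longleftrightarrow> is_factorization V \<rho> \<and> is_factorization V \<sigma>"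
  by (auto simp: is_factorization_def)

lemma is_factorization_take: "is_factorization V \<rho> \<Longrightarrow> is_factorization V (take k \<rho>)"
  by (auto simp: is_factorization_def dest: in_set_takeD)

lemma conj_perm_eq: "conj_perm h g = inv h \<circ> g \<circ> h"
  by (simp add: conj_perm_def fcomp_comp comp_assoc)

lemma conj_perm_fcomp:
  assumes "bij g" and "bij h"
  shows "conj_perm (fcomp g h) \<tau> = conj_perm g (conj_perm h \<tau>)"
  using assms by (simp add: conj_perm_eq fcomp_comp o_inv_distrib comp_assoc)

lemma conj_perm_moves_iff:
  assumes "bij h"
  shows "conj_perm h g x \<noteq> x \<longleftrightarrow> g (h x) \<noteq> h x"
  unfolding conj_perm_eq o_apply using assms by (metis bij_inv_eq_iff)

lemma conj_perm_in_transpositions: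
  assumes "h permutes V" and "\<tau> \<in> transpositions V"
  shows "conj_perm h \<tau> \<in> transpositions V"
proof -
  obtain a b where ab: "\<tau> = transpose a b" "a \<in> V" "b \<in> V" "a \<noteq> b"
    using assms(2) by (auto simp: transpositions_def)
  have h: "bij h"
    using assms(1) by (rule permutes_bij)
  have "conj_perm h \<tau> = inv h \<circ> (h \<circ> transpose (inv h a) (inv h b))"
    using h by (simp add: conj_perm_eq ab(1) comp_assoc transpose_comp_eq)
  also have "\<dots> = transpose (inv h a) (inv h b)"
    using h by (simp add: bij_is_inj flip: comp_assoc)
  finally have "conj_perm h \<tau> = transpose (inv h a) (inv h b)" .
  moreover have "inv h a \<in> V" "inv h b \<in> V"
    using ab permutes_inv[OF assms(1)] by (simp_all add: permutes_in_image)
  moreover have "inv h a \<noteq> inv h b"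
    using h ab(4) by (metis bij_inv_eq_iff)
  ultimately show ?thesis
    unfolding transpositions_def by blast
qed

lemma moved_points_transposition:
  assumes "\<tau> \<in> transpositions V" and "\<tau> v \<noteq> v"
  shows "{x \<in> V. \<tau> x \<noteq> x} = {v, \<tau> v}"
  using assms by (auto simp: transpositions_def transpose_def split: if_splits)

lemma edge_transposition_moved_points:
  assumes "\<tau> \<in> transpositions V"
  shows "edge_transposition {x \<in> V. \<tau> x \<noteq> x} = \<tau>"
proof -
  obtain a b where ab: "\<tau> = transpose a b" "a \<in> V" "b \<in> V" "a \<noteq> b"
    using assms by (auto simp: transpositions_def)
  have "{x \<in> V. \<tau> x \<noteq> x} = {a, b}"
    using moved_points_transposition[OF assms, of a] ab by simp
  then show ?thesis
    unfolding edge_transposition_def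
    using ab by (intro the_equality) (auto simp: doubleton_eq_iff transpose_commute)
qed

section \<open>Greedy trails follow the prefix products\<close>

lemma labels_at_above_egraph_of:
  "labels_at_above (egraph_of V \<rho>) v i =
    {j. i < j \<and> j \<le> length \<rho> \<and> v \<in> V \<and> (\<rho> ! (j - 1)) v \<noteq> v}"
  by (auto simp: labels_at_above_def egraph_of_def)

text \<open>
  A greedy trail that has just dealt with the edges of \<open>\<alpha>\<close> either ignores the next edge, because
  that edge is not incident to the current vertex, or has to take it, because it is the smallest
  one available.
\<close>

lemma greedy_steps_fixed:
  assumes "\<tau> v = v"
  shows "greedy_steps (egraph_of V (\<alpha> @ \<tau> # \<beta>)) v (length \<alpha>) =
    greedy_steps (egraph_of V (\<alpha> @ \<tau> # \<beta>)) v (Suc (length \<alpha>))"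
proof -
  let ?G = "egraph_of V (\<alpha> @ \<tau> # \<beta>)"
  have "Suc (length \<alpha>) \<notin> labels_at_above ?G v (length \<alpha>)"
    using assms by (simp add: labels_at_above_egraph_of)
  then have "labels_at_above ?G v (length \<alpha>) = labels_at_above ?G v (Suc (length \<alpha>))"
    by (auto simp: labels_at_above_def intro!: Suc_lessI)
  then show ?thesis
    using greedy_steps.simps[of ?G v "length \<alpha>"] greedy_steps.simps[of ?G v "Suc (length \<alpha>)"]
    by simp
qed

lemma greedy_steps_moved:
  assumes "\<tau> \<in> transpositions V" and "v \<in> V" and "\<tau> v \<noteq> v"
  shows "greedy_steps (egraph_of V (\<alpha> @ \<tau> # \<beta>)) v (length \<alpha>) =
    (Suc (length \<alpha>), \<tau> v) #
      greedy_steps (egraph_of V (\<alpha> @ \<tau> # \<beta>)) (\<tau> v) (Suc (length \<alpha>))"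
proof -
  let ?G = "egraph_of V (\<alpha> @ \<tau> # \<beta>)"
  let ?L = "labels_at_above ?G v (length \<alpha>)"
  have mem: "Suc (length \<alpha>) \<in> ?L"
    using assms by (simp add: labels_at_above_egraph_of)
  have "finite ?L"
    by (simp add: labels_at_above_def)
  then have Min: "Min ?L = Suc (length \<alpha>)"
    using mem by (intro Min_eqI) (auto simp: labels_at_above_def)
  have "ends ?G (Suc (length \<alpha>)) = {v, \<tau> v}"
    using moved_points_transposition[OF assms(1,3)] by (simp add: egraph_of_def)
  then have "other_end ?G (Suc (length \<alpha>)) v = \<tau> v"
    unfolding other_end_def by (intro the_equality) (auto simp: doubleton_eq_iff)
  with mem Min show ?thesis
    using greedy_steps.simps[of ?G v "length \<alpha>"] by (auto simp: Let_def)
qed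

lemma greedy_steps_labels_greater:
  assumes "j \<in> fst ` set (greedy_steps G v i)"
  shows "i < j"
  using assms
proof (induction G v i rule: greedy_steps.induct)
  case (1 G v i)
  let ?L = "labels_at_above G v i"
  show ?case
  proof (cases "?L = {}")
    case True
    with "1.prems" show ?thesis
      using greedy_steps.simps[of G v i] by simp
  next
    case False
    then have "Min ?L \<in> ?L"
      by (intro Min_in) (simp_all add: labels_at_above_def)
    then have "i < Min ?L"
      by (simp add: labels_at_above_def)
    moreover have "j = Min ?L \<or> j \<in> fst ` set (greedy_steps G (other_end G (Min ?L) v) (Min ?L))"
      using "1.prems" False greedy_steps.simps[of G v i] by (auto simp: Let_def)
    ultimately show ?thesis
      using "1.IH"[OF False refl refl] less_trans by blast
  qed
qed

text \<open>
  In both cases the trail continues from the image of the current vertex under the transposition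
  of the edge just dealt with, which gives the description of trails by prefix products. For the
  induction on the remaining part \<open>\<beta>\<close> of the factorization, the part \<open>\<alpha>\<close> already dealt with has to
  be arbitrary. The shift by one is due to labels starting at 1 and list positions at 0.
\<close>

lemma greedy_steps_labels:
  assumes "is_factorization V \<beta>" and "v \<in> V" and "k < length \<beta>"
  shows "Suc (length \<alpha> + k) \<in> fst ` set (greedy_steps (egraph_of V (\<alpha> @ \<beta>)) v (length \<alpha>)) \<longleftrightarrow>
    (\<beta> ! k) (monodromy (take k \<beta>) v) \<noteq> monodromy (take k \<beta>) v"
  using assms
proof (induction \<beta> arbitrary: \<alpha> v k)
  case Nil
  then show ?case by simp
next
  case (Cons \<tau> \<beta>)
  let ?S = "\<lambda>v i. fst ` set (greedy_steps (egraph_of V (\<alpha> @ \<tau> # \<beta>)) v i)"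
  have \<tau>: "\<tau> \<in> transpositions V" and \<beta>: "is_factorization V \<beta>"
    using Cons.prems(1) by (auto simp: is_factorization_def)
  have \<tau>v: "\<tau> v \<in> V"
    using Cons.prems(2) transpositions_permutes[OF \<tau>] by (simp add: permutes_in_image)
  have step: "?S v (length \<alpha>) =
      (if \<tau> v = v then {} else {Suc (length \<alpha>)}) \<union> ?S (\<tau> v) (Suc (length \<alpha>))"
    using greedy_steps_fixed[of \<tau> v V \<alpha> \<beta>] greedy_steps_moved[OF \<tau> Cons.prems(2), of \<alpha> \<beta>]
    by simp
  show ?case
  proof (cases k)
    case 0
    have "Suc (length \<alpha>) \<notin> ?S (\<tau> v) (Suc (length \<alpha>))"
      using greedy_steps_labels_greater less_irrefl by metis
    with 0 step show ?thesis by auto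
  next
    case (Suc l)
    then have "l < length \<beta>"
      using Cons.prems(3) by simp
    from Cons.IH[OF \<beta> \<tau>v this, of "\<alpha> @ [\<tau>]"] Suc show ?thesis
      unfolding step by simp
  qed
qed

section \<open>The dual of a concatenation\<close>

lemma length_mind_body_dual [simp]: "length (mind_body_dual V \<rho>) = length \<rho>"
  by (simp add: mind_body_dual_def factorization_of_def dual_egraph_def egraph_of_def
      del: upt_Suc)

lemma mind_body_dual_nth:
  assumes "is_factorization V \<rho>" and "i < length \<rho>"
  shows "mind_body_dual V \<rho> ! i = conj_perm (monodromy (take i \<rho>)) (\<rho> ! i)"
proof -
  let ?h = "monodromy (take i \<rho>)"
  have h: "?h permutes V"
    using assms(1) by (intro monodromy_permutes is_factorization_take)
  have "\<rho> ! i \<in> transpositions V"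
    using assms by (auto simp: is_factorization_def)
  then have conj: "conj_perm ?h (\<rho> ! i) \<in> transpositions V"
    by (rule conj_perm_in_transpositions[OF h])
  have "Suc i \<in> trail_labels (migt (egraph_of V \<rho>) v) \<longleftrightarrow> conj_perm ?h (\<rho> ! i) v \<noteq> v"
    if "v \<in> V" for v
    using greedy_steps_labels[OF assms(1) that assms(2), of "[]"]
      conj_perm_moves_iff[OF permutes_bij[OF h], of "\<rho> ! i" v]
    by (simp add: trail_labels_def migt_def)
  then have "ends (dual_egraph (egraph_of V \<rho>)) (Suc i) =
      {v \<in> V. conj_perm ?h (\<rho> ! i) v \<noteq> v}"
    by (auto simp: dual_egraph_def egraph_of_def)
  moreover have "mind_body_dual V \<rho> ! i =
      edge_transposition (ends (dual_egraph (egraph_of V \<rho>)) (Suc i))"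
    using assms(2)
    by (simp add: mind_body_dual_def factorization_of_def dual_egraph_def egraph_of_def del: upt_Suc)
  ultimately show ?thesis
    by (simp add: edge_transposition_moved_points[OF conj])
qed

lemma mind_body_dual_append:
  assumes "is_factorization V \<rho>" and "is_factorization V \<sigma>"
  shows "mind_body_dual V (\<rho> @ \<sigma>) =
    mind_body_dual V \<rho> @ conj_factorization (monodromy \<rho>) (mind_body_dual V \<sigma>)"
proof (rule nth_equalityI)
  show "length (mind_body_dual V (\<rho> @ \<sigma>)) =
      length (mind_body_dual V \<rho> @ conj_factorization (monodromy \<rho>) (mind_body_dual V \<sigma>))"
    by (simp add: conj_factorization_def)
next
  fix i
  assume "i < length (mind_body_dual V (\<rho> @ \<sigma>))"
  then have i: "i < length (\<rho> @ \<sigma>)" by simp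
  have \<rho>\<sigma>: "is_factorization V (\<rho> @ \<sigma>)"
    using assms by simp
  show "mind_body_dual V (\<rho> @ \<sigma>) ! i =
      (mind_body_dual V \<rho> @ conj_factorization (monodromy \<rho>) (mind_body_dual V \<sigma>)) ! i"
  proof (cases "i < length \<rho>")
    case True
    then show ?thesis
      using mind_body_dual_nth[OF \<rho>\<sigma> i] mind_body_dual_nth[OF assms(1) True]
      by (simp add: nth_append)
  next
    case False
    let ?l = "i - length \<rho>"
    have l: "?l < length \<sigma>"
      using i False by auto
    have "bij (monodromy \<rho>)" "bij (monodromy (take ?l \<sigma>))"
      using assms by (auto intro!: permutes_bij monodromy_permutes is_factorization_take)
    then show ?thesis
      using mind_body_dual_nth[OF \<rho>\<sigma> i] mind_body_dual_nth[OF assms(2) l] False l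
      by (simp add: nth_append conj_factorization_def monodromy_append conj_perm_fcomp)
  qed
qed

theorem theorem3p7:
  fixes V :: "'a set" and \<rho> :: "'a factorization" and \<rho>s :: "'a factorization list"
  assumes "finite V"
    and "\<forall>\<sigma>\<in>set \<rho>s. is_factorization V \<sigma>"
    and "\<rho> = concat \<rho>s"
  shows "mind_body_dual V \<rho> =
    concat (map (\<lambda>j. conj_factorization (monodromy (concat (take j \<rho>s))) (mind_body_dual V (\<rho>s ! j)))
      [0..<length \<rho>s])"
  using assms(2) unfolding assms(3)
proof (induction \<rho>s rule: rev_induct)
  case Nil
  show ?case
    by (simp flip: length_0_conv)
next
  case (snoc \<sigma> \<rho>s)
  have "is_factorization V (concat \<rho>s)" "is_factorization V \<sigma>"
    using snoc.prems by (auto simp: is_factorization_def)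
  then have "mind_body_dual V (concat (\<rho>s @ [\<sigma>])) =
      mind_body_dual V (concat \<rho>s) @
      conj_factorization (monodromy (concat \<rho>s)) (mind_body_dual V \<sigma>)"
    by (simp add: mind_body_dual_append)
  also have "mind_body_dual V (concat \<rho>s) =
      concat (map (\<lambda>j. conj_factorization (monodromy (concat (take j (\<rho>s @ [\<sigma>]))))
        (mind_body_dual V ((\<rho>s @ [\<sigma>]) ! j))) [0..<length \<rho>s])"
    using snoc by (auto simp: nth_append intro!: arg_cong[where f = concat] map_cong)
  finally show ?case
    by simp
qed

end
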